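(* Let $S$ be a semigroup and let $\sigma:S\to S$ be an involutive morphism. Let $\mu$ be a complex measure that is a linear combination of Dirac measures $(\delta_{z_i})_{i\in I}$ such that $z_i$ is contained in the center of $S$ for all $i\in I$. Let $\delta>0$ be fixed. If $f:S\to\mathbb{C}$ satisfies $$\left|\int_S f(xyt)\,d\mu(t)+\int_S f(x\sigma(y)t)\,d\mu(t)-2f(x)f(y)\right|\leq\delta\quad\text{for all }x,y\in S,$$ then either $f$ is bounded and $$|f(x)|\leq\frac{\|\mu\|+\sqrt{\|\mu\|^2+2\delta}}{2}\quad\text{for all }x\in S,$$ or $f$ satisfies $$\int_S f(xyt)\,d\mu(t)+\int_S f(x\sigma(y)t)\,d\mu(t)=2f(x)f(y)\quad\text{for all }x,y\in S.$$
   Context: A semigroup is a set with an associative operation, written multiplicatively. An involutive morphism of $S$ is a map $\sigma:S\to S$ with $\sigma(\sigma(x))=x$ for all $x\in S$ that is either an automorphism ($\sigma(xy)=\sigma(x)\sigma(y)$ for all $x,y\in S$) or an anti-automorphism ($\sigma(xy)=\sigma(y)\sigma(x)$ for all $x,y\in S$). The measure is $\mu=\sum_{i\in I}\alpha_i\delta_{z_i}$ (finite linear combination, $\alpha_i\in\mathbb{C}$), so $\int_S h(t)\,d\mu(t)=\sum_i\alpha_i h(z_i)$; $\|\mu\|$ denotes its total variation norm. *)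

theory Defs
  imports "HOL-Probability.Probability"
begin

definition involutive_morphism :: "('a::semigroup_mult \<Rightarrow> 'a) \<Rightarrow> bool" where
  "involutive_morphism \<sigma> \<longleftrightarrow>
     (\<forall>x. \<sigma> (\<sigma> x) = x) \<and>
     ((\<forall>x y. \<sigma> (x * y) = \<sigma> x * \<sigma> y) \<or> (\<forall>x y. \<sigma> (x * y) = \<sigma> y * \<sigma> x))"

definition semigroup_center :: "'a::semigroup_mult set" where
  "semigroup_center = {z. \<forall>x. z * x = x * z}"

text \<open>The Dirac measure on the discrete sigma-algebra (all subsets), so that every complex-valued
  function is measurable.\<close>

abbreviation dirac :: "'a \<Rightarrow> 'a measure" where
  "dirac z \<equiv> return (count_space UNIV) z"

text \<open>HOL-Analysis has no complex measures. The two definitions below give the complex measure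
  \<open>\<mu> = (\<Sum>i\<in>I. \<alpha> i \<cdot> \<delta>\<^bsub>z i\<^esub>)\<close> as a set function on all subsets, and integration
  against it. The points \<open>z i\<close> need not be distinct.\<close>

definition dirac_comb :: "'i set \<Rightarrow> ('i \<Rightarrow> complex) \<Rightarrow> ('i \<Rightarrow> 'a) \<Rightarrow> 'a set \<Rightarrow> complex" where
  "dirac_comb I \<alpha> z A = (\<Sum>i\<in>I. \<alpha> i * complex_of_real (measure (dirac (z i)) A))"

definition dirac_comb_integral ::
    "'i set \<Rightarrow> ('i \<Rightarrow> complex) \<Rightarrow> ('i \<Rightarrow> 'a) \<Rightarrow> ('a \<Rightarrow> complex) \<Rightarrow> complex" where
  "dirac_comb_integral I \<alpha> z h = (\<Sum>i\<in>I. \<alpha> i * (LINT t|dirac (z i). h t))"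

text \<open>The total variation norm \<open>\<bar>\<mu>\<bar>(UNIV)\<close> of a complex measure defined on all subsets: the supremum
  over finite partitions of the whole space. As a supremum of reals it is only meaningful when these
  sums are bounded above, which \<open>bdd_above_variation_dirac_comb\<close> below shows for \<open>dirac_comb\<close>.\<close>

definition total_variation_norm :: "('a set \<Rightarrow> complex) \<Rightarrow> real" where
  "total_variation_norm \<mu> =
     (SUP P \<in> {P. finite P \<and> partition_on UNIV P}. \<Sum>A\<in>P. cmod (\<mu> A))"

lemma dirac_comb_eq: "dirac_comb I \<alpha> z A = (\<Sum>i\<in>I. \<alpha> i * indicator A (z i))"
  unfolding dirac_comb_def
  by (intro sum.cong refl) (simp add: measure_return indicator_def)

lemma dirac_comb_integral_eq: "dirac_comb_integral I \<alpha> z h = (\<Sum>i\<in>I. \<alpha> i * h (z i))"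
  unfolding dirac_comb_integral_def
  by (intro sum.cong refl) (simp add: integral_return)

lemma variation_dirac_comb_le:
  assumes "finite P" "partition_on UNIV P"
  shows "(\<Sum>A\<in>P. cmod (dirac_comb I \<alpha> z A)) \<le> (\<Sum>i\<in>I. cmod (\<alpha> i))"
proof -
  have one: "(\<Sum>A\<in>P. indicator A x :: real) = 1" for x
  proof -
    obtain B where B: "B \<in> P" "x \<in> B"
      using partition_onD1[OF assms(2)] by blast
    have "A = B" if "A \<in> P" "x \<in> A" for A
      using that B partition_onD2[OF assms(2)] unfolding disjoint_def by blast
    then have "(\<Sum>A\<in>P. indicator A x :: real) = (\<Sum>A\<in>P. if A = B then 1 else 0)"
      using B by (intro sum.cong refl) (metis indicator_simps)
    then show ?thesis
      using B assms(1) by simp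
  qed
  have "(\<Sum>A\<in>P. cmod (dirac_comb I \<alpha> z A)) \<le> (\<Sum>A\<in>P. \<Sum>i\<in>I. cmod (\<alpha> i) * indicator A (z i))"
    unfolding dirac_comb_eq
    by (rule sum_mono, rule sum_norm_le) (simp add: norm_mult indicator_def)
  also have "\<dots> = (\<Sum>i\<in>I. cmod (\<alpha> i) * (\<Sum>A\<in>P. indicator A (z i)))"
    unfolding sum_distrib_left by (rule sum.swap)
  finally show ?thesis
    by (simp add: one)
qed

lemma bdd_above_variation_dirac_comb:
  "bdd_above ((\<lambda>P. \<Sum>A\<in>P. cmod (dirac_comb I \<alpha> z A)) ` {P. finite P \<and> partition_on UNIV P})"
  by (rule bdd_aboveI2[where M = "\<Sum>i\<in>I. cmod (\<alpha> i)"]) (simp add: variation_dirac_comb_le)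

end

theory Submission
  imports Defs
begin

text \<open>Write \<open>F x\<close> for the integral of \<open>t \<mapsto> f (x t)\<close>, and let \<open>f\<close> be unbounded. A quantity whose
  product with \<open>f w\<close> stays bounded in \<open>w\<close> must vanish. This principle gives in turn \<open>f \<circ> \<sigma> = f\<close>,
  then \<open>F \<circ> \<sigma> = F\<close> (the difference is bounded at all points \<open>x z\<^sub>i\<close> because \<open>z\<^sub>i\<close> is central), then
  \<open>f x * F y = F x * f y\<close>, so that \<open>F = c f\<close>. Hence \<open>g = f / c\<close> satisfies the d'Alembert inequality
  \<open>\<bar>g (x y) + g (x \<sigma>(y)) - 2 g x g y\<bar> \<le> \<epsilon>\<close>, whose superstability is proved by expanding
  \<open>2 g w (g (x y) + g (x \<sigma>(y)) - 2 g x g y)\<close>. In the bounded case, the bound is the positive root of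
  \<open>M\<^sup>2 = \<parallel>\<mu>\<parallel> M + \<delta> / 2\<close>.\<close>

section \<open>Unboundedness arguments, and central elements under \<open>\<sigma>\<close>\<close>

lemma eq_0_if_mult_unbounded:
  fixes f :: "'a \<Rightarrow> complex"
  assumes "\<not> bounded (range f)" and K: "\<And>w. cmod (f w * c) \<le> K"
  shows "c = 0"
proof (rule ccontr)
  assume "c \<noteq> 0"
  then have "cmod (f w) \<le> K / cmod c" for w
    using K[of w] by (simp add: norm_mult pos_le_divide_eq)
  then have "bounded (range f)"
    by (auto simp: bounded_iff)
  with assms(1) show False ..
qed

lemma involutive_morphism_involutive:
  "involutive_morphism \<sigma> \<Longrightarrow> \<sigma> (\<sigma> x) = x"
  by (simp add: involutive_morphism_def)

lemma semigroup_center_commute: "z \<in> semigroup_center \<Longrightarrow> z * x = x * z"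
  by (simp add: semigroup_center_def)

lemma involutive_morphism_center:
  assumes "involutive_morphism \<sigma>" "z \<in> semigroup_center"
  shows "\<sigma> z \<in> semigroup_center"
proof -
  have "\<sigma> z * x = x * \<sigma> z" for x
    using assms involutive_morphism_involutive[OF assms(1), of x]
      semigroup_center_commute[OF assms(2), of "\<sigma> x"]
    unfolding involutive_morphism_def by metis
  then show ?thesis
    by (simp add: semigroup_center_def)
qed

text \<open>An anti-automorphism reverses the product, but \<open>\<sigma> z\<close> is again
  central, so the order can be restored. This lets the reduction to d'Alembert treat both kinds of
  morphism at once.\<close>

lemma involutive_morphism_mult_center:
  assumes "involutive_morphism \<sigma>" "z \<in> semigroup_center"
  shows "\<sigma> (x * z) = \<sigma> x * \<sigma> z"
  using assms semigroup_center_commute[OF involutive_morphism_center[OF assms], of "\<sigma> x"]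
  unfolding involutive_morphism_def by metis

text \<open>Replacing \<open>y\<close> by \<open>\<sigma> y\<close> only swaps the two
  \<open>F\<close> terms, so they cancel in the difference of the two estimates. With
  \<open>F\<close> arbitrary this serves both the integral and the plain d'Alembert inequality
  (\<open>F = f\<close>).\<close>

lemma even_if_approx:
  fixes \<sigma> :: "'a::semigroup_mult \<Rightarrow> 'a" and f F :: "'a \<Rightarrow> complex"
  assumes "\<And>x. \<sigma> (\<sigma> x) = x" "\<not> bounded (range f)"
    and D: "\<And>x y. cmod (F (x * y) + F (x * \<sigma> y) - 2 * f x * f y) \<le> \<delta>"
  shows "f (\<sigma> y) = f y"
proof -
  have "cmod (f w * (2 * (f (\<sigma> y) - f y))) \<le> \<delta> + \<delta>" for w
  proof -
    have "f w * (2 * (f (\<sigma> y) - f y)) =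
        (F (w * y) + F (w * \<sigma> y) - 2 * f w * f y)
        - (F (w * \<sigma> y) + F (w * \<sigma> (\<sigma> y)) - 2 * f w * f (\<sigma> y))"
      by (simp add: assms(1) algebra_simps)
    then show ?thesis
      using norm_triangle_le_diff add_mono[OF D[of w y] D[of w "\<sigma> y"]] by metis
  qed
  from eq_0_if_mult_unbounded[OF assms(2) this] show ?thesis
    by simp
qed

section \<open>Superstability of d'Alembert's equation\<close>

lemma dAlembert_superstable:
  fixes \<sigma> :: "'a::semigroup_mult \<Rightarrow> 'a" and g :: "'a \<Rightarrow> complex"
  assumes \<sigma>: "involutive_morphism \<sigma>" and unb: "\<not> bounded (range g)"
    and approx: "\<And>x y. cmod (g (x * y) + g (x * \<sigma> y) - 2 * g x * g y) \<le> \<epsilon>"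
  shows "g (x * y) + g (x * \<sigma> y) = 2 * g x * g y"
proof -
  note inv = involutive_morphism_involutive[OF \<sigma>]
  define D where "D x y = g (x * y) + g (x * \<sigma> y) - 2 * g x * g y" for x y
  have D: "cmod (D x y) \<le> \<epsilon>" for x y
    using approx by (simp add: D_def)
  have even: "g (\<sigma> x) = g x" for x
    by (rule even_if_approx[OF inv unb approx])
  have D_prod: "cmod (2 * g x * D y w) \<le> 2 * cmod (g x) * \<epsilon>" for x y w
    using D[of y w] by (simp add: norm_mult mult_left_mono)
  consider (aut) "\<And>x y. \<sigma> (x * y) = \<sigma> x * \<sigma> y" | (anti) "\<And>x y. \<sigma> (x * y) = \<sigma> y * \<sigma> x"
    using \<sigma> unfolding involutive_morphism_def by blast
  then have "D x y = 0"
  proof cases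
    case aut
    have "cmod (g w * (2 * D x y)) \<le> \<epsilon> + \<epsilon> + 2 * cmod (g x) * \<epsilon> + \<epsilon> + \<epsilon>" for w
    proof -
      \<comment> \<open>The four values of \<open>g\<close> at triple products arise from both
        bracketings, \<open>x (y w)\<close> and \<open>(x y) w\<close>, and cancel.\<close>
      have "g w * (2 * D x y) = D x (y * w) + D x (y * \<sigma> w) + 2 * g x * D y w
          - D (x * y) w - D (x * \<sigma> y) w"
        by (simp add: D_def aut inv algebra_simps)
      then show ?thesis
        by (simp only:) (intro norm_triangle_le_diff norm_triangle_mono add_mono D D_prod)
    qed
    from eq_0_if_mult_unbounded[OF unb this] show ?thesis
      by simp
  next
    case anti
    define C where "C x y = g (x * y) - g (y * x)" for x y
    have sym: "g (y * \<sigma> x) = g (x * \<sigma> y)" for x y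
      using even[of "x * \<sigma> y"] by (simp add: anti inv)
    have C_eq: "C x y = D x y - D y x" for x y
      by (simp add: C_def D_def sym[of x y])
    have C: "cmod (C x y) \<le> \<epsilon> + \<epsilon>" for x y
      unfolding C_eq by (intro norm_triangle_le_diff add_mono D)
    \<comment> \<open>Now \<open>\<sigma> (y * w)\<close> is \<open>\<sigma> w * \<sigma> y\<close>,
      so two triple products come in the wrong order. The bounded commutator defect \<open>C\<close>
      moves \<open>\<sigma> y\<close> to the front, which turns \<open>g (x * \<sigma> y)\<close>
      into \<open>g (\<sigma> y * x)\<close>.\<close>
    have D_eq: "D x y = C x (\<sigma> y)" for x y
    proof -
      have "cmod (g w * (2 * (D x y - C x (\<sigma> y)))) \<le>
          \<epsilon> + \<epsilon> + 2 * cmod (g x) * \<epsilon> + \<epsilon> + (\<epsilon> + \<epsilon>) + (\<epsilon> + \<epsilon>) + \<epsilon>" for w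
      proof -
        have "g w * (2 * (D x y - C x (\<sigma> y))) =
            D x (y * w) + D x (y * \<sigma> w) + 2 * g x * D y w - D (x * y) w
            - C (x * w) (\<sigma> y) - C (x * \<sigma> w) (\<sigma> y) - D (\<sigma> y * x) w"
          by (simp add: D_def C_def anti inv algebra_simps)
        then show ?thesis
          by (simp only:) (intro norm_triangle_le_diff norm_triangle_mono add_mono D D_prod C)
      qed
      from eq_0_if_mult_unbounded[OF unb this] show ?thesis
        by simp
    qed
    have D_C: "D x y = C x y" for x y
      using D_eq[of x "\<sigma> y"] by (simp add: D_def inv even add.commute)
    \<comment> \<open>\<open>D = C\<close> is antisymmetric, so \<open>C_eq\<close> reads
      \<open>D x y = 2 * D x y\<close>.\<close>
    have "D y x = - D x y"
      by (simp add: D_C C_def)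
    then have "D x y = D x y - (- D x y)"
      using C_eq[of x y] D_C[of x y] by metis
    then show ?thesis
      by simp
  qed
  then show ?thesis
    by (simp add: D_def)
qed

section \<open>Reduction of the unbounded case to d'Alembert's equation\<close>

lemma central_superstable:
  fixes \<sigma> :: "'a::semigroup_mult \<Rightarrow> 'a" and f :: "'a \<Rightarrow> complex"
  assumes \<sigma>: "involutive_morphism \<sigma>" and z: "\<And>i. i \<in> I \<Longrightarrow> z i \<in> semigroup_center"
    and unb: "\<not> bounded (range f)"
    and F_def: "\<And>x. F x = (\<Sum>i\<in>I. \<alpha> i * f (x * z i))"
    and approx: "\<And>x y. cmod (F (x * y) + F (x * \<sigma> y) - 2 * f x * f y) \<le> \<delta>"
  shows "F (x * y) + F (x * \<sigma> y) = 2 * f x * f y"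
proof -
  note inv = involutive_morphism_involutive[OF \<sigma>]
  note center_\<sigma> = involutive_morphism_center[OF \<sigma>]
  note mult_center = involutive_morphism_mult_center[OF \<sigma>]
  note comm = semigroup_center_commute
  define D where "D x y = F (x * y) + F (x * \<sigma> y) - 2 * f x * f y" for x y
  have D: "cmod (D x y) \<le> \<delta>" for x y
    using approx by (simp add: D_def)
  have even: "f (\<sigma> x) = f x" for x
    by (rule even_if_approx[OF inv unb approx])
  define A where "A = (\<Sum>i\<in>I. cmod (\<alpha> i))"
  have sum_bound: "cmod (\<Sum>i\<in>I. \<alpha> i * h i) \<le> A * K"
    if "\<And>i. i \<in> I \<Longrightarrow> cmod (h i) \<le> K" for h :: "_ \<Rightarrow> complex" and K
    unfolding A_def sum_distrib_right
    by (rule sum_norm_le) (simp add: norm_mult mult_left_mono that)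
  \<comment> \<open>By evenness of \<open>f\<close>, passing from \<open>x\<close> to
    \<open>\<sigma> x\<close> amounts to replacing each atom \<open>z i\<close> by its image under
    \<open>\<sigma>\<close>.\<close>
  have F_\<sigma>: "F (\<sigma> x) = (\<Sum>i\<in>I. \<alpha> i * f (x * \<sigma> (z i)))" for x
    unfolding F_def
  proof (intro sum.cong refl)
    fix i assume "i \<in> I"
    then have "f (x * \<sigma> (z i)) = f (\<sigma> x * z i)"
      using even[of "x * \<sigma> (z i)"] by (simp add: mult_center z center_\<sigma> inv)
    then show "\<alpha> i * f (\<sigma> x * z i) = \<alpha> i * f (x * \<sigma> (z i))"
      by simp
  qed
  define H where "H x = F x - F (\<sigma> x)" for x
  \<comment> \<open>Compare the pairs \<open>x, \<sigma> c\<close> and \<open>\<sigma> c, x\<close>: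
    centrality cancels \<open>F (x * \<sigma> c)\<close>. The bound covers only multiples of central
    elements, not yet every \<open>x\<close>.\<close>
  have H_bound: "cmod (H (x * c)) \<le> \<delta> + \<delta>" if c: "c \<in> semigroup_center" for x c
  proof -
    have "\<sigma> (x * c) = \<sigma> c * \<sigma> x"
      using c by (simp add: mult_center comm[OF center_\<sigma>])
    then have "H (x * c) = D x (\<sigma> c) - D (\<sigma> c) x"
      using c by (simp add: H_def D_def inv comm[OF center_\<sigma>])
    then show ?thesis
      by (simp only:) (intro norm_triangle_le_diff add_mono D)
  qed
  have swap: "(\<Sum>i\<in>I. \<alpha> i * F (x * \<sigma> (z i))) = (\<Sum>i\<in>I. \<alpha> i * F (\<sigma> (x * z i)))" for x
  proof -
    have "(\<Sum>i\<in>I. \<alpha> i * F (x * \<sigma> (z i))) =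
        (\<Sum>i\<in>I. \<Sum>j\<in>I. \<alpha> i * (\<alpha> j * f (x * \<sigma> (z i) * z j)))"
      by (simp add: F_def sum_distrib_left)
    also have "\<dots> = (\<Sum>j\<in>I. \<Sum>i\<in>I. \<alpha> j * (\<alpha> i * f (x * z j * \<sigma> (z i))))"
      by (subst sum.swap) (intro sum.cong refl, simp add: mult.assoc mult.left_commute comm[OF z])
    finally show ?thesis
      by (simp add: F_\<sigma> sum_distrib_left)
  qed
  have F_even: "F (\<sigma> x) = F x" for x
  proof -
    have "cmod (f w * (2 * H x)) \<le>
        A * (\<delta> + \<delta>) + A * (\<delta> + \<delta>) + A * (\<delta> + \<delta>)" for w
    proof -
      have *: "D (x * c) w = F (x * w * c) + F (x * \<sigma> w * c) - 2 * f (x * c) * f w"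
        if "c \<in> semigroup_center" for c
        by (simp add: D_def mult.assoc comm[OF that, of w] comm[OF that, of "\<sigma> w"])
      \<comment> \<open>Summing \<open>D (x * z i) w - D (x * \<sigma> (z i)) w\<close> yields
        \<open>-2 * f w * H x\<close> together with \<open>F\<close> terms; \<open>swap\<close>
        collects these into values of \<open>H\<close> at the points \<open>x * w * z i\<close> and
        \<open>x * \<sigma> w * z i\<close>, where \<open>H_bound\<close> applies.\<close>
      have "f w * (2 * H x) =
          (\<Sum>i\<in>I. \<alpha> i * H (x * w * z i)) + (\<Sum>i\<in>I. \<alpha> i * H (x * \<sigma> w * z i))
          - (\<Sum>i\<in>I. \<alpha> i * (D (x * z i) w - D (x * \<sigma> (z i)) w))"
        (is "_ = ?S1 + ?S2 - ?S3")
      proof -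
        have "?S1 = (\<Sum>i\<in>I. \<alpha> i * F (x * w * z i)) - (\<Sum>i\<in>I. \<alpha> i * F (x * w * \<sigma> (z i)))"
          unfolding swap by (simp add: H_def right_diff_distrib sum_subtractf)
        moreover have "?S2 =
            (\<Sum>i\<in>I. \<alpha> i * F (x * \<sigma> w * z i)) - (\<Sum>i\<in>I. \<alpha> i * F (x * \<sigma> w * \<sigma> (z i)))"
          unfolding swap by (simp add: H_def right_diff_distrib sum_subtractf)
        moreover have "?S3 =
            (\<Sum>i\<in>I. \<alpha> i * F (x * w * z i) + \<alpha> i * F (x * \<sigma> w * z i)
               - \<alpha> i * F (x * w * \<sigma> (z i)) - \<alpha> i * F (x * \<sigma> w * \<sigma> (z i))
               - 2 * f w * (\<alpha> i * f (x * z i)) + 2 * f w * (\<alpha> i * f (x * \<sigma> (z i))))"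
          by (intro sum.cong refl) (simp add: * z center_\<sigma> algebra_simps)
        moreover have "\<dots> = (\<Sum>i\<in>I. \<alpha> i * F (x * w * z i)) + (\<Sum>i\<in>I. \<alpha> i * F (x * \<sigma> w * z i))
            - (\<Sum>i\<in>I. \<alpha> i * F (x * w * \<sigma> (z i))) - (\<Sum>i\<in>I. \<alpha> i * F (x * \<sigma> w * \<sigma> (z i)))
            - 2 * f w * F x + 2 * f w * F (\<sigma> x)"
          by (simp only: sum.distrib sum_subtractf sum_distrib_left[symmetric] F_\<sigma> F_def[of x])
        ultimately show ?thesis
          by (simp only: H_def) (simp only: algebra_simps)
      qed
      then show ?thesis
        by (simp only:)
          (intro norm_triangle_le_diff norm_triangle_mono add_mono sum_bound H_bound D z)
    qed
    from eq_0_if_mult_unbounded[OF unb this] show ?thesis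
      by (simp add: H_def)
  qed
  have cross_approx: "cmod (f x * (2 * (2 * F y)) - f y * (2 * (2 * F x))) \<le>
      A * (\<delta> + \<delta> + (\<delta> + \<delta>))" for x y
  proof -
    \<comment> \<open>Adding the terms for \<open>c\<close> and \<open>\<sigma> c\<close> is what
      makes the \<open>F\<close> values cancel: \<open>c\<close> may be moved between the arguments
      of \<open>D\<close>, but inside the second one it is also hit by
      \<open>\<sigma>\<close>.\<close>
    have E: "f x * (2 * (f (y * c) + f (y * \<sigma> c))) - f y * (2 * (f (x * c) + f (x * \<sigma> c)))
        = D (x * c) y + D (x * \<sigma> c) y - (D x (y * c) + D x (y * \<sigma> c))"
      if "c \<in> semigroup_center" for c
      using that comm[OF that] comm[OF center_\<sigma>[OF that]]
      by (simp add: D_def mult_center center_\<sigma> inv)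
        (simp add: mult.assoc distrib_left)
    have two_F: "2 * F x = (\<Sum>i\<in>I. \<alpha> i * (f (x * z i) + f (x * \<sigma> (z i))))" for x
      using F_\<sigma>[of x] by (simp add: F_even F_def[of x] sum.distrib distrib_left)
    have "f x * (2 * (2 * F y)) - f y * (2 * (2 * F x)) =
        (\<Sum>i\<in>I. \<alpha> i * (f x * (2 * (f (y * z i) + f (y * \<sigma> (z i))))
                         - f y * (2 * (f (x * z i) + f (x * \<sigma> (z i))))))"
      unfolding two_F sum_distrib_left sum_subtractf[symmetric]
      by (intro sum.cong refl) (simp add: algebra_simps)
    also have "\<dots> = (\<Sum>i\<in>I. \<alpha> i * (D (x * z i) y + D (x * \<sigma> (z i)) y
        - (D x (y * z i) + D x (y * \<sigma> (z i)))))"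
      by (intro sum.cong refl) (simp only: E z)
    finally show ?thesis
      by (simp only:) (intro sum_bound norm_triangle_le_diff norm_triangle_mono add_mono D)
  qed
  have cross: "f x * F y = f y * F x" for x y
  proof -
    let ?B = "A * (\<delta> + \<delta> + (\<delta> + \<delta>))"
    have "cmod (f w * (4 * (f x * F y - f y * F x))) \<le> cmod (f x) * ?B + cmod (f y) * ?B" for w
    proof -
      \<comment> \<open>The terms containing \<open>F w\<close> cancel, leaving a product with
        \<open>f w\<close> whose bound depends only on \<open>x\<close> and
        \<open>y\<close>.\<close>
      have "f w * (4 * (f x * F y - f y * F x)) =
          f x * (f w * (2 * (2 * F y)) - f y * (2 * (2 * F w)))
          - f y * (f w * (2 * (2 * F x)) - f x * (2 * (2 * F w)))"
        by (simp add: algebra_simps)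
      then show ?thesis
        by (simp only:)
          (intro norm_triangle_le_diff add_mono, simp_all only: norm_mult[of "f _"],
            (intro mult_left_mono cross_approx norm_ge_zero)+)
    qed
    from eq_0_if_mult_unbounded[OF unb this] show ?thesis
      by simp
  qed
  obtain u where u: "f u \<noteq> 0"
    using unb by (metis bounded_iff norm_zero order_refl rangeE)
  define c where "c = F u / f u"
  have F: "F x = c * f x" for x
    using cross[of u x] u by (simp add: c_def field_simps)
  have "c \<noteq> 0"
  proof
    assume "c = 0"
    then have "cmod (f w * (2 * f u)) \<le> \<delta>" for w
      using D[of w u] by (simp add: D_def F mult.commute mult.left_commute)
    from eq_0_if_mult_unbounded[OF unb this] u show False
      by simp
  qed
  \<comment> \<open>With \<open>F = c f\<close> and \<open>f = c g\<close>, all three terms of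
    \<open>D\<close> carry the factor \<open>c\<^sup>2\<close>, so \<open>g\<close> satisfies
    d'Alembert's inequality with constant \<open>\<delta> / (cmod c)\<^sup>2\<close>.\<close>
  define g where "g x = f x / c" for x
  have f: "f x = c * g x" for x
    using \<open>c \<noteq> 0\<close> by (simp add: g_def)
  have D_g: "D x y = c\<^sup>2 * (g (x * y) + g (x * \<sigma> y) - 2 * g x * g y)" for x y
    by (simp add: D_def F f power2_eq_square algebra_simps)
  have "g (x * y) + g (x * \<sigma> y) = 2 * g x * g y"
  proof (rule dAlembert_superstable[OF \<sigma>])
    show "\<not> bounded (range g)"
    proof
      assume "bounded (range g)"
      then have "bounded ((*) c ` range g)"
        by (rule bounded_linear_image) (rule bounded_linear_mult_right)
      with unb show False
        by (simp add: image_image f[symmetric])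
    qed
    show "cmod (g (x * y) + g (x * \<sigma> y) - 2 * g x * g y) \<le> \<delta> / (cmod c)\<^sup>2" for x y
      using D[of x y] \<open>c \<noteq> 0\<close>
      by (simp add: D_g norm_mult norm_power pos_le_divide_eq mult.commute)
  qed
  then have "D x y = 0"
    by (simp add: D_g)
  then show ?thesis
    by (simp add: D_def)
qed

section \<open>Total variation and the bounded case\<close>

lemma sum_atoms_le_total_variation_norm:
  assumes "finite Z"
  shows "(\<Sum>p\<in>Z. cmod (dirac_comb I \<alpha> z {p})) \<le> total_variation_norm (dirac_comb I \<alpha> z)"
proof -
  let ?\<mu> = "dirac_comb I \<alpha> z"
  \<comment> \<open>The complement of \<open>Z\<close> completes the singletons to a partition; it
    is dropped when empty, since blocks must be nonempty.\<close>
  let ?P = "(\<lambda>p. {p}) ` Z \<union> ({- Z} - {{}})"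
  have "partition_on UNIV ?P"
    by (auto simp: partition_on_def disjoint_def)
  then have "(\<Sum>A\<in>?P. cmod (?\<mu> A)) \<le> total_variation_norm ?\<mu>"
    unfolding total_variation_norm_def
    using assms by (intro cSUP_upper bdd_above_variation_dirac_comb) simp
  moreover have "(\<Sum>p\<in>Z. cmod (?\<mu> {p})) = (\<Sum>A\<in>(\<lambda>p. {p}) ` Z. cmod (?\<mu> A))"
    by (subst sum.reindex) (simp_all add: inj_on_def)
  moreover have "\<dots> \<le> (\<Sum>A\<in>?P. cmod (?\<mu> A))"
    using assms by (intro sum_mono2) auto
  ultimately show ?thesis
    by linarith
qed

text \<open>Points \<open>z i\<close> may coincide and their coefficients may cancel, so the sum is
  first grouped by atoms; the triangle inequality over \<open>I\<close> would give only the possibly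
  larger sum of the \<open>cmod (\<alpha> i)\<close>.\<close>

lemma dirac_comb_integral_le:
  assumes "finite I" and h: "\<And>t. cmod (h t) \<le> M"
  shows "cmod (dirac_comb_integral I \<alpha> z h) \<le> total_variation_norm (dirac_comb I \<alpha> z) * M"
proof -
  have "dirac_comb_integral I \<alpha> z h = (\<Sum>p\<in>z ` I. \<Sum>i\<in>{i\<in>I. z i = p}. \<alpha> i * h (z i))"
    unfolding dirac_comb_integral_eq using assms(1) by (rule sum.image_gen)
  also have "\<dots> = (\<Sum>p\<in>z ` I. dirac_comb I \<alpha> z {p} * h p)"
  proof (intro sum.cong refl)
    fix p
    have "(\<Sum>i\<in>{i\<in>I. z i = p}. \<alpha> i * h (z i)) = (\<Sum>i\<in>I. if z i = p then \<alpha> i * h (z i) else 0)"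
      using assms(1) by (rule sum.inter_filter)
    also have "\<dots> = dirac_comb I \<alpha> z {p} * h p"
      unfolding dirac_comb_eq sum_distrib_right by (intro sum.cong refl) auto
    finally show "(\<Sum>i\<in>{i\<in>I. z i = p}. \<alpha> i * h (z i)) = dirac_comb I \<alpha> z {p} * h p" .
  qed
  also have "cmod \<dots> \<le> (\<Sum>p\<in>z ` I. cmod (dirac_comb I \<alpha> z {p}) * M)"
    by (rule sum_norm_le) (simp add: norm_mult h mult_left_mono)
  also have "\<dots> \<le> total_variation_norm (dirac_comb I \<alpha> z) * M"
    unfolding sum_distrib_right[symmetric]
  proof (rule mult_right_mono)
    show "0 \<le> M"
      using h norm_ge_zero order_trans by blast
  qed (simp add: sum_atoms_le_total_variation_norm assms(1))
  finally show ?thesis .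
qed

text \<open>Since \<open>quad\<close> holds for every upper bound \<open>M\<close>, it can be used
  with the supremum of \<open>cmod (f x)\<close>. This gives a quadratic inequality for
  \<open>M\<close>, solved by completing the square.\<close>

lemma bound_if_quadratic_bound:
  fixes f :: "'a \<Rightarrow> complex"
  assumes "bounded (range f)"
    and quad: "\<And>M x. (\<And>y. cmod (f y) \<le> M) \<Longrightarrow> 2 * (cmod (f x))\<^sup>2 \<le> 2 * (N * M) + \<delta>"
  shows "cmod (f x) \<le> (N + sqrt (N\<^sup>2 + 2 * \<delta>)) / 2"
proof -
  define M where "M = (SUP x. cmod (f x))"
  have "bdd_above (range (\<lambda>x. cmod (f x)))"
    using assms(1) by (auto simp: bounded_iff bdd_above_def)
  then have M: "cmod (f y) \<le> M" for y
    unfolding M_def by (rule cSUP_upper2) auto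
  have "cmod (f y) \<le> sqrt (N * M + \<delta> / 2)" for y
    using quad[OF M, of y] by (intro real_le_rsqrt) simp
  then have "M \<le> sqrt (N * M + \<delta> / 2)"
    unfolding M_def by (intro cSUP_least) auto
  moreover have "0 \<le> M"
    using M norm_ge_zero order_trans by blast
  moreover have "0 \<le> N * M + \<delta> / 2"
    using quad[OF M, of x] zero_le_power2[of "cmod (f x)"] by linarith
  ultimately have "M\<^sup>2 \<le> N * M + \<delta> / 2"
    using power_mono[of M "sqrt (N * M + \<delta> / 2)" 2] by simp
  then have "(2 * M - N)\<^sup>2 \<le> N\<^sup>2 + 2 * \<delta>"
    by (simp add: power2_eq_square algebra_simps)
  then have "2 * M - N \<le> sqrt (N\<^sup>2 + 2 * \<delta>)"
    by (rule real_le_rsqrt)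
  with M[of x] show ?thesis
    by simp
qed


theorem theorem3p2:
  fixes \<sigma> :: "'a::semigroup_mult \<Rightarrow> 'a"
    and I :: "'i set" and \<alpha> :: "'i \<Rightarrow> complex" and z :: "'i \<Rightarrow> 'a"
    and \<delta> :: real and f :: "'a \<Rightarrow> complex"
  assumes "involutive_morphism \<sigma>"
    and "finite I"
    and "\<And>i. i \<in> I \<Longrightarrow> z i \<in> semigroup_center"
    and "\<delta> > 0"
    and "\<And>x y. cmod (dirac_comb_integral I \<alpha> z (\<lambda>t. f (x * y * t))
                   + dirac_comb_integral I \<alpha> z (\<lambda>t. f (x * \<sigma> y * t)) - 2 * f x * f y) \<le> \<delta>"
  shows "(bounded (range f) \<and>
           (\<forall>x. cmod (f x) \<le> (total_variation_norm (dirac_comb I \<alpha> z)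
                   + sqrt ((total_variation_norm (dirac_comb I \<alpha> z))\<^sup>2 + 2 * \<delta>)) / 2)) \<or>
         (\<forall>x y. dirac_comb_integral I \<alpha> z (\<lambda>t. f (x * y * t))
                   + dirac_comb_integral I \<alpha> z (\<lambda>t. f (x * \<sigma> y * t)) = 2 * f x * f y)"
proof (cases "bounded (range f)")
  case True
  let ?N = "total_variation_norm (dirac_comb I \<alpha> z)"
  have quad: "2 * (cmod (f x))\<^sup>2 \<le> 2 * (?N * M) + \<delta>" if M: "\<And>y. cmod (f y) \<le> M" for M x
  proof -
    let ?u = "dirac_comb_integral I \<alpha> z (\<lambda>t. f (x * x * t))"
    let ?v = "dirac_comb_integral I \<alpha> z (\<lambda>t. f (x * \<sigma> x * t))"
    \<comment> \<open>The hypothesis is taken at \<open>y = x\<close>, with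
      \<open>2 * f x * f x\<close> written as the two integrals minus the defect.\<close>
    have "cmod (?u + ?v - (?u + ?v - 2 * f x * f x)) \<le> ?N * M + ?N * M + \<delta>"
      by (intro norm_triangle_le_diff norm_triangle_mono add_mono
          dirac_comb_integral_le assms(2) M assms(5))
    then show ?thesis
      by (simp add: norm_mult power2_eq_square mult.commute mult.left_commute)
  qed
  show ?thesis
    using True bound_if_quadratic_bound[OF True quad] by blast
next
  case False
  with assms(1,3,5) have "dirac_comb_integral I \<alpha> z (\<lambda>t. f (x * y * t))
      + dirac_comb_integral I \<alpha> z (\<lambda>t. f (x * \<sigma> y * t)) = 2 * f x * f y" for x y
    by (intro central_superstable[where I = I and \<alpha> = \<alpha> and z = z and \<delta> = \<delta>
          and F = "\<lambda>x. dirac_comb_integral I \<alpha> z (\<lambda>t. f (x * t))"])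
      (simp_all add: dirac_comb_integral_eq)
  then show ?thesis
    by blast
qed

end
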